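(* Let $\lambda_1>\lambda_2>\lambda_3>\lambda_4$ be real numbers with $\lambda_i+\lambda_j>0$ for all $i\neq j$, and consider the $\mathfrak{so}(4)$ free rigid body system on $\mathfrak{so}(4)\cong\mathbb{R}^6$ (coordinates $(x_1,x_2,x_3,y_1,y_2,y_3)$) given in the context. Let $c_1,c_2\in\mathbb{R}$ with $c_1>0$, $c_1>|c_2|$, and set $$a=\tfrac{1}{\sqrt2}\left(\sqrt{c_1+c_2}+\sqrt{c_1-c_2}\right),\qquad b=\tfrac{1}{\sqrt2}\left(\sqrt{c_1+c_2}-\sqrt{c_1-c_2}\right).$$ Then: (i) The equilibria $M^1_{a,b}$ and $M^1_{-a,-b}$ are nonlinearly stable with Lyapunov function $G_3+mC_1+nC_2$. (ii) The equilibria $M^3_{a,b}$ and $M^3_{-a,-b}$ are nonlinearly stable with Lyapunov function $G_1+mC_1+nC_2$. (iii) The equilibria $M^3_{b,a}$ and $M^3_{-b,-a}$ are nonlinearly stable with Lyapunov function $G_4+mC_1+nC_2$. Here, for an equilibrium $M_e$ and a constant of motion $G$, the phrase "$M_e$ is nonlinearly stable with Lyapunov function $G+mC_1+nC_2$" means: there are real numbers $m,n$ such that $F:=G+mC_1+nC_2$ satisfies $dF(M_e)=0$ and the restriction of the Hessian $d^2F(M_e)$ to $W\times W$, where $W=\ker dC_1(M_e)\cap\ker dC_2(M_e)$, is (positive or negative) definite; and $M_e$ is a Lyapunov stable equilibrium of the system.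
   Context: The $\mathfrak{so}(4)$ free rigid body is the system $\dot M=[M,\Omega]$, $M=\Omega J+J\Omega$, $J=\operatorname{diag}(\lambda_1,\dots,\lambda_4)$, $M,\Omega\in\mathfrak{so}(4)$. Writing $$M=\begin{pmatrix}0&-x_3&x_2&y_1\\ x_3&0&-x_1&y_2\\ -x_2&x_1&0&y_3\\ -y_1&-y_2&-y_3&0\end{pmatrix}$$ and $\lambda_{ij}:=\lambda_i+\lambda_j$, it reads $$\begin{aligned} \dot x_1&=\left(\tfrac1{\lambda_{12}}-\tfrac1{\lambda_{13}}\right)x_2x_3+\left(\tfrac1{\lambda_{34}}-\tfrac1{\lambda_{24}}\right)y_2y_3, & \dot y_1&=\left(\tfrac1{\lambda_{34}}-\tfrac1{\lambda_{13}}\right)x_2y_3+\left(\tfrac1{\lambda_{12}}-\tfrac1{\lambda_{24}}\right)x_3y_2,\\ \dot x_2&=\left(\tfrac1{\lambda_{23}}-\tfrac1{\lambda_{12}}\right)x_1x_3+\left(\tfrac1{\lambda_{14}}-\tfrac1{\lambda_{34}}\right)y_1y_3, & \dot y_2&=\left(\tfrac1{\lambda_{23}}-\tfrac1{\lambda_{34}}\right)x_1y_3+\left(\tfrac1{\lambda_{14}}-\tfrac1{\lambda_{12}}\right)x_3y_1,\\ \dot x_3&=\left(\tfrac1{\lambda_{13}}-\tfrac1{\lambda_{23}}\right)x_1x_2+\left(\tfrac1{\lambda_{24}}-\tfrac1{\lambda_{14}}\right)y_1y_2, & \dot y_3&=\left(\tfrac1{\lambda_{24}}-\tfrac1{\lambda_{23}}\right)x_1y_2+\left(\tfrac1{\lambda_{13}}-\tfrac1{\lambda_{14}}\right)x_2y_1.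 \end{aligned}$$ Casimir functions (constants of motion): $C_1=\frac12\sum_{i=1}^3(x_i^2+y_i^2)$, $C_2=\sum_{i=1}^3x_iy_i$. Further constants of motion: $$G_1=\frac{x_2^2}{\lambda_1^2-\lambda_3^2}+\frac{x_3^2}{\lambda_1^2-\lambda_2^2}+\frac{y_1^2}{\lambda_1^2-\lambda_4^2},\qquad G_3=\frac{x_1^2}{\lambda_3^2-\lambda_2^2}+\frac{x_2^2}{\lambda_3^2-\lambda_1^2}+\frac{y_3^2}{\lambda_3^2-\lambda_4^2},$$ $$G_4=\frac{y_1^2}{\lambda_4^2-\lambda_1^2}+\frac{y_2^2}{\lambda_4^2-\lambda_2^2}+\frac{y_3^2}{\lambda_4^2-\lambda_3^2}.$$ Equilibria: for $\alpha,\beta\in\mathbb{R}$, $M^1_{\alpha,\beta}$ is the point with $x_1=\alpha$, $y_1=\beta$ and all other coordinates $0$; $M^3_{\alpha,\beta}$ is the point with $x_3=\alpha$, $y_3=\beta$ and all other coordinates $0$. With $a,b$ as in the claim, the points considered lie on the regular adjoint orbit $\{C_1=c_1,\ C_2=c_2\}$. *)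

theory Defs
  imports "HOL-Analysis.Analysis"
begin

text \<open>Phase space: so(4) is identified with \<open>real^3 \<times> real^3\<close>, the point \<open>(x, y)\<close> having
  coordinates \<open>x1, x2, x3, y1, y2, y3\<close>.\<close>

type_synonym so4 = "(real^3) \<times> (real^3)"

lemma vector_4:
  "(vector [w, x, y, z] :: ('a::zero)^4)$1 = w"
  "(vector [w, x, y, z] :: ('a::zero)^4)$2 = x"
  "(vector [w, x, y, z] :: ('a::zero)^4)$3 = y"
  "(vector [w, x, y, z] :: ('a::zero)^4)$4 = z"
  unfolding vector_def by simp_all

definition so4_matrix :: "so4 \<Rightarrow> real^4^4" where
  "so4_matrix = (\<lambda>(x, y). vector
     [vector [    0, - x$3,   x$2, y$1],
      vector [  x$3,     0, - x$1, y$2],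
      vector [- x$2,   x$1,     0, y$3],
      vector [- y$1, - y$2, - y$3,   0]])"

definition diag_matrix :: "real^4 \<Rightarrow> real^4^4" where
  "diag_matrix l = (\<chi> i j. if i = j then l$i else 0)"

definition lam2 :: "real^4 \<Rightarrow> 4 \<Rightarrow> 4 \<Rightarrow> real" where
  "lam2 l i j = l$i + l$j"

definition rigid_body :: "real^4 \<Rightarrow> so4 \<Rightarrow> so4" where
  "rigid_body l = (\<lambda>(x, y).
     (vector
       [(1 / lam2 l 1 2 - 1 / lam2 l 1 3) * x$2 * x$3 + (1 / lam2 l 3 4 - 1 / lam2 l 2 4) * y$2 * y$3,
        (1 / lam2 l 2 3 - 1 / lam2 l 1 2) * x$1 * x$3 + (1 / lam2 l 1 4 - 1 / lam2 l 3 4) * y$1 * y$3,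
        (1 / lam2 l 1 3 - 1 / lam2 l 2 3) * x$1 * x$2 + (1 / lam2 l 2 4 - 1 / lam2 l 1 4) * y$1 * y$2],
      vector
       [(1 / lam2 l 3 4 - 1 / lam2 l 1 3) * x$2 * y$3 + (1 / lam2 l 1 2 - 1 / lam2 l 2 4) * x$3 * y$2,
        (1 / lam2 l 2 3 - 1 / lam2 l 3 4) * x$1 * y$3 + (1 / lam2 l 1 4 - 1 / lam2 l 1 2) * x$3 * y$1,
        (1 / lam2 l 2 4 - 1 / lam2 l 2 3) * x$1 * y$2 + (1 / lam2 l 1 3 - 1 / lam2 l 1 4) * x$2 * y$1]))"

text \<open>The vector field above is the matrix system \<open>M' = [M, \<Omega>]\<close> with \<open>M = \<Omega>J + J\<Omega>\<close>.\<close>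

lemma rigid_body_matrix:
  fixes l :: "real^4" and \<Omega> :: "real^4^4"
  assumes pos: "\<And>i j. i \<noteq> j \<Longrightarrow> l$i + l$j > 0"
    and skew: "transpose \<Omega> = - \<Omega>"
    and M: "so4_matrix p = \<Omega> ** diag_matrix l + diag_matrix l ** \<Omega>"
  shows "so4_matrix (rigid_body l p) = so4_matrix p ** \<Omega> - \<Omega> ** so4_matrix p"
proof -
  have M_entry: "so4_matrix p $ i $ j = \<Omega>$i$j * (l$i + l$j)" for i j
  proof -
    have "(\<Omega> ** diag_matrix l) $ i $ j = \<Omega>$i$j * l$j"
      by (simp add: matrix_matrix_mult_def diag_matrix_def if_distrib cong: if_cong)
    moreover have "(diag_matrix l ** \<Omega>) $ i $ j = l$i * \<Omega>$i$j"
      by (simp add: matrix_matrix_mult_def diag_matrix_def if_distrib if_distribR cong: if_cong)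
    ultimately show ?thesis
      unfolding M by (simp add: distrib_left mult.commute)
  qed
  have skew_entry: "\<Omega>$j$i = - \<Omega>$i$j" for i j
    using arg_cong[OF skew, of "\<lambda>A. A$i$j"] by (simp add: transpose_def)
  have diag: "\<Omega>$i$i = 0" for i
    using skew_entry[of i i] by simp
  obtain x y where p: "p = (x, y)"
    by (cases p)
  have sums: "l$1 + l$2 \<noteq> 0" "l$1 + l$3 \<noteq> 0" "l$1 + l$4 \<noteq> 0"
    "l$2 + l$3 \<noteq> 0" "l$2 + l$4 \<noteq> 0" "l$3 + l$4 \<noteq> 0"
    using pos[of 1 2] pos[of 1 3] pos[of 1 4] pos[of 2 3] pos[of 2 4] pos[of 3 4] by simp_all
  have entries: "\<Omega>$1$2 = - x$3 * (1 / lam2 l 1 2)" "\<Omega>$1$3 = x$2 * (1 / lam2 l 1 3)"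
    "\<Omega>$1$4 = y$1 * (1 / lam2 l 1 4)" "\<Omega>$2$3 = - x$1 * (1 / lam2 l 2 3)"
    "\<Omega>$2$4 = y$2 * (1 / lam2 l 2 4)" "\<Omega>$3$4 = y$3 * (1 / lam2 l 3 4)"
    using sums M_entry[of 1 2] M_entry[of 1 3] M_entry[of 1 4] M_entry[of 2 3] M_entry[of 2 4]
      M_entry[of 3 4]
    by (simp_all add: p so4_matrix_def vector_4 lam2_def nonzero_eq_divide_eq)
  show ?thesis
    unfolding vec_eq_iff forall_4 vector_minus_component matrix_matrix_mult_def vec_lambda_beta
      sum_4 diag skew_entry[of 2 1] skew_entry[of 3 1] skew_entry[of 4 1] skew_entry[of 3 2]
      skew_entry[of 4 2] skew_entry[of 4 3] entries p so4_matrix_def rigid_body_def prod.case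
      vector_4 vector_3
    by (intro conjI; algebra)
qed

definition C1 :: "so4 \<Rightarrow> real" where
  "C1 = (\<lambda>(x, y). 1/2 * (\<Sum>i\<in>UNIV. (x$i)\<^sup>2 + (y$i)\<^sup>2))"

definition C2 :: "so4 \<Rightarrow> real" where
  "C2 = (\<lambda>(x, y). \<Sum>i\<in>UNIV. x$i * y$i)"

definition G1 :: "real^4 \<Rightarrow> so4 \<Rightarrow> real" where
  "G1 l = (\<lambda>(x, y). (x$2)\<^sup>2 / ((l$1)\<^sup>2 - (l$3)\<^sup>2) + (x$3)\<^sup>2 / ((l$1)\<^sup>2 - (l$2)\<^sup>2)
     + (y$1)\<^sup>2 / ((l$1)\<^sup>2 - (l$4)\<^sup>2))"

definition G3 :: "real^4 \<Rightarrow> so4 \<Rightarrow> real" where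
  "G3 l = (\<lambda>(x, y). (x$1)\<^sup>2 / ((l$3)\<^sup>2 - (l$2)\<^sup>2) + (x$2)\<^sup>2 / ((l$3)\<^sup>2 - (l$1)\<^sup>2)
     + (y$3)\<^sup>2 / ((l$3)\<^sup>2 - (l$4)\<^sup>2))"

definition G4 :: "real^4 \<Rightarrow> so4 \<Rightarrow> real" where
  "G4 l = (\<lambda>(x, y). (y$1)\<^sup>2 / ((l$4)\<^sup>2 - (l$1)\<^sup>2) + (y$2)\<^sup>2 / ((l$4)\<^sup>2 - (l$2)\<^sup>2)
     + (y$3)\<^sup>2 / ((l$4)\<^sup>2 - (l$3)\<^sup>2))"

definition M1 :: "real \<Rightarrow> real \<Rightarrow> so4" where
  "M1 \<alpha> \<beta> = (vector [\<alpha>, 0, 0], vector [\<beta>, 0, 0])"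

definition M3 :: "real \<Rightarrow> real \<Rightarrow> so4" where
  "M3 \<alpha> \<beta> = (vector [0, 0, \<alpha>], vector [0, 0, \<beta>])"

definition is_solution :: "('a::real_normed_vector \<Rightarrow> 'a) \<Rightarrow> real set \<Rightarrow> (real \<Rightarrow> 'a) \<Rightarrow> bool" where
  "is_solution f I u \<longleftrightarrow> (\<forall>t\<in>I. (u has_vector_derivative f (u t)) (at t within I))"

text \<open>Stability in the sense of Lyapunov: solutions starting near \<open>z\<close> exist for all \<open>t \<ge> 0\<close>, and
  every forward solution starting near \<open>z\<close>, on whatever interval \<open>[0, T)\<close> it is defined, stays
  near \<open>z\<close>.\<close>

definition lyapunov_stable :: "('a::real_normed_vector \<Rightarrow> 'a) \<Rightarrow> 'a \<Rightarrow> bool" where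
  "lyapunov_stable f z \<longleftrightarrow> f z = 0 \<and>
     (\<forall>\<epsilon>>0. \<exists>\<delta>>0. \<forall>z0. dist z0 z < \<delta> \<longrightarrow>
        (\<exists>u. is_solution f {0..} u \<and> u 0 = z0) \<and>
        (\<forall>T>0. \<forall>u. is_solution f {0..<T} u \<and> u 0 = z0 \<longrightarrow> (\<forall>t\<in>{0..<T}. dist (u t) z < \<epsilon>)))"

text \<open>The Hessian as an iterated Fr\'echet derivative. As \<open>frechet_derivative\<close> is a choice
  operator, this is meaningful for twice differentiable \<open>F\<close>; below it is only applied to
  polynomials.\<close>

definition hessian :: "('a::real_normed_vector \<Rightarrow> real) \<Rightarrow> 'a \<Rightarrow> 'a \<Rightarrow> 'a \<Rightarrow> real" where
  "hessian F z v w = frechet_derivative (\<lambda>p. frechet_derivative F (at p) w) (at z) v"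

definition definite_on :: "'a::real_vector set \<Rightarrow> ('a \<Rightarrow> 'a \<Rightarrow> real) \<Rightarrow> bool" where
  "definite_on W B \<longleftrightarrow> (\<forall>v\<in>W. v \<noteq> 0 \<longrightarrow> B v v > 0) \<or> (\<forall>v\<in>W. v \<noteq> 0 \<longrightarrow> B v v < 0)"

definition casimir_kernel :: "so4 \<Rightarrow> so4 set" where
  "casimir_kernel z =
     {v. frechet_derivative C1 (at z) v = 0} \<inter> {v. frechet_derivative C2 (at z) v = 0}"

definition nonlinearly_stable_with :: "real^4 \<Rightarrow> (so4 \<Rightarrow> real) \<Rightarrow> so4 \<Rightarrow> bool" where
  "nonlinearly_stable_with l G z \<longleftrightarrow>
     (\<exists>m n. let F = (\<lambda>p. G p + m * C1 p + n * C2 p) in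
        frechet_derivative F (at z) = (\<lambda>_. 0) \<and>
        definite_on (casimir_kernel z) (hessian F z)) \<and>
     lyapunov_stable (rigid_body l) z"

end

theory Submission
  imports Defs
begin

text \<open>Each constant of motion is a quadratic form, so \<open>F = G + m C1 + n C2\<close> is half of a quadratic
  form \<open>Q\<close>, and \<open>dF(z) = 0\<close> says that \<open>z\<close> lies in the radical of \<open>Q\<close>. At an equilibrium
  on the \<open>(x_k, y_k)\<close> plane the kernel of the differentials of the Casimirs is spanned by the remaining
  coordinate axes, where \<open>Q\<close> splits into two binary forms with positive determinants. Definiteness
  makes \<open>z\<close> isolated in its joint level set of \<open>C1\<close>, \<open>C2\<close>, \<open>Q\<close>; by compactness of small spheres, solutions
  starting near \<open>z\<close> cannot leave a neighbourhood. Solutions are global because \<open>C1\<close> is half the squared norm.\<close>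

section \<open>Global solutions for globally Lipschitz vector fields\<close>

lemma integral_has_vector_derivative_atLeast:
  fixes \<phi> :: "real \<Rightarrow> 'a::banach"
  assumes "continuous_on {0..} \<phi>" and "0 \<le> t"
  shows "((\<lambda>t. integral {0..t} \<phi>) has_vector_derivative \<phi> t) (at t within {0..})"
proof -
  have "at t within {0..} = at t within {0..t+1}"
    by (rule at_within_nhd[where S = "{..<t+1}"]) auto
  moreover have "continuous_on {0..t+1} \<phi>"
    using assms(1) by (rule continuous_on_subset) auto
  ultimately show ?thesis
    using integral_has_vector_derivative[of 0 "t+1" \<phi> t] assms(2) by simp
qed

text \<open>Integrating \<open>exp (k * s)\<close> gains a factor \<open>1 / k\<close>; a large k
  thus makes the weighted integral operator below a contraction on the whole half-line.\<close>

lemma norm_integral_exp_le: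
  fixes \<phi> :: "real \<Rightarrow> 'a::banach"
  assumes "continuous_on {0..} \<phi>" and "0 \<le> t" and "0 < k" and "0 \<le> C"
    and bound: "\<And>s. 0 \<le> s \<Longrightarrow> norm (\<phi> s) \<le> C * exp (k * s)"
  shows "norm (integral {0..t} \<phi>) \<le> C / k * exp (k * t)"
proof -
  have int: "((\<lambda>s. C * exp (k * s)) has_integral (C / k * exp (k * t) - C / k * exp (k * 0))) {0..t}"
    using assms(2,3)
    by (intro fundamental_theorem_of_calculus)
      (auto intro!: derivative_eq_intros simp flip: has_real_derivative_iff_has_vector_derivative)
  have "\<phi> integrable_on {0..t}"
    by (rule integrable_continuous_real, rule continuous_on_subset[OF assms(1)]) auto
  then have "norm (integral {0..t} \<phi>) \<le> integral {0..t} (\<lambda>s. C * exp (k * s))"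
    using int by (intro Henstock_Kurzweil_Integration.integral_norm_bound_integral bound) (auto simp: has_integral_iff)
  also have "\<dots> \<le> C / k * exp (k * t)"
    using int assms(3,4) by (simp add: has_integral_iff)
  finally show ?thesis .
qed

text \<open>Rewritten for the unknown \<open>v t = exp (- k * t) *\<^sub>R u t\<close>, the Picard
  integral equation becomes a fixed point equation among bounded continuous functions. The weight
  lets one contraction serve all times t \<ge> 0, without gluing local solutions.\<close>

lemma lipschitz_global_solution:
  fixes g :: "'a::banach \<Rightarrow> 'a"
  assumes lip: "L-lipschitz_on UNIV g"
  shows "\<exists>u. is_solution g {0..} u \<and> u 0 = z0"
proof -
  \<comment> \<open>Any k > L would do, since the contraction factor below is \<open>L / k\<close>;
    the \<open>+ 1\<close> keeps k positive when L = 0.\<close>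
  define k where "k = 2 * L + 1"
  have L: "0 \<le> L" using lip lipschitz_on_nonneg by blast
  then have k: "0 < k" by (simp add: k_def)
  define \<phi> where "\<phi> v s = g (exp (k * s) *\<^sub>R apply_bcontfun v s)" for v :: "real \<Rightarrow>\<^sub>C 'a" and s
  \<comment> \<open>This is the weighted Picard operator. Bounded continuous functions live on the
    whole line, so \<open>max 0 t\<close> extends it to negative times by its value at 0.\<close>
  define \<Phi> where "\<Phi> v t = exp (- k * max 0 t) *\<^sub>R (z0 + integral {0..max 0 t} (\<phi> v))" for v t
  have g_cont: "continuous_on UNIV g"
    by (rule lipschitz_on_continuous_on[OF lip])
  have \<phi>_cont: "continuous_on S (\<phi> v)" for v S
    unfolding \<phi>_def
    by (intro continuous_on_compose2[OF g_cont] continuous_intros continuous_on_apply_bcontfun) auto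
  have \<Phi>_cont: "continuous_on UNIV (\<Phi> v)" for v
  proof -
    have "continuous_on {0..} (\<lambda>t. integral {0..t} (\<phi> v))"
      unfolding continuous_on_eq_continuous_within
      by (auto intro!: has_vector_derivative_continuous integral_has_vector_derivative_atLeast \<phi>_cont)
    then show ?thesis
      unfolding \<Phi>_def
      by (intro continuous_intros continuous_on_compose2[where f = "\<lambda>t. max 0 t"]) auto
  qed
  have \<Phi>_bound: "norm (\<Phi> v t) \<le> norm z0 + (norm (g 0) + L * norm v) / k" for v t
  proof -
    define \<tau> where "\<tau> = max 0 t"
    have "norm (\<phi> v s) \<le> (norm (g 0) + L * norm v) * exp (k * s)" if "0 \<le> s" for s
    proof -
      have "norm (\<phi> v s) \<le> norm (g 0) + dist (\<phi> v s) (g 0)"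
        by (metis dist_norm norm_triangle_sub)
      also have "\<dots> \<le> norm (g 0) + L * (exp (k * s) * norm (apply_bcontfun v s))"
        using lipschitz_onD[OF lip, of "exp (k * s) *\<^sub>R apply_bcontfun v s" 0] by (simp add: \<phi>_def)
      also have "\<dots> \<le> norm (g 0) * exp (k * s) + L * (exp (k * s) * norm v)"
        using that k L norm_bounded[of v s]
        by (intro add_mono mult_left_mono) (auto simp: mult_le_cancel_left1)
      finally show ?thesis by (simp add: algebra_simps)
    qed
    then have I: "norm (integral {0..\<tau>} (\<phi> v)) \<le> (norm (g 0) + L * norm v) / k * exp (k * \<tau>)"
      using L k by (intro norm_integral_exp_le \<phi>_cont) (auto simp: \<tau>_def)
    have "norm (\<Phi> v t) \<le> exp (- k * \<tau>) * (norm z0 + norm (integral {0..\<tau>} (\<phi> v)))"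
      by (simp add: \<Phi>_def \<tau>_def norm_triangle_ineq)
    also have "\<dots> \<le> exp (- k * \<tau>) * (norm z0 + (norm (g 0) + L * norm v) / k * exp (k * \<tau>))"
      using I by simp
    also have "\<dots> = exp (- k * \<tau>) * norm z0 + (norm (g 0) + L * norm v) / k"
      by (simp add: algebra_simps exp_minus)
    also have "\<dots> \<le> norm z0 + (norm (g 0) + L * norm v) / k"
      using k by (intro add_right_mono mult_left_le_one_le) (auto simp: \<tau>_def)
    finally show ?thesis .
  qed
  define T where "T v = Bcontfun (\<Phi> v)" for v
  have T: "apply_bcontfun (T v) = \<Phi> v" for v
    unfolding T_def using \<Phi>_cont \<Phi>_bound
    by (intro Bcontfun_inverse bcontfun_normI) auto
  have contraction: "dist (T v) (T w) \<le> (L / k) * dist v w" for v w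
  proof (rule dist_bound)
    fix t :: real
    define \<tau> where "\<tau> = max 0 t"
    have D: "norm (\<phi> v s - \<phi> w s) \<le> (L * dist v w) * exp (k * s)" for s
    proof -
      have "norm (\<phi> v s - \<phi> w s) \<le> L * (exp (k * s) * dist (apply_bcontfun v s) (apply_bcontfun w s))"
        using lipschitz_onD[OF lip, of "exp (k * s) *\<^sub>R apply_bcontfun v s"
            "exp (k * s) *\<^sub>R apply_bcontfun w s"]
        by (simp add: \<phi>_def dist_norm flip: scaleR_diff_right)
      also have "\<dots> \<le> L * (exp (k * s) * dist v w)"
        using L dist_bounded[of v s w] by (intro mult_left_mono) auto
      finally show ?thesis by (simp add: algebra_simps)
    qed
    have "norm (integral {0..\<tau>} (\<lambda>s. \<phi> v s - \<phi> w s)) \<le> (L * dist v w) / k * exp (k * \<tau>)"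
      using L k D by (intro norm_integral_exp_le continuous_intros \<phi>_cont) (auto simp: \<tau>_def)
    moreover have "\<Phi> v t - \<Phi> w t = exp (- k * \<tau>) *\<^sub>R integral {0..\<tau>} (\<lambda>s. \<phi> v s - \<phi> w s)"
      using integral_diff[of "\<phi> v" "{0..\<tau>}" "\<phi> w"]
      by (simp add: \<Phi>_def \<tau>_def integrable_continuous_real \<phi>_cont flip: scaleR_diff_right)
    ultimately have "norm (\<Phi> v t - \<Phi> w t) \<le> exp (- k * \<tau>) * ((L * dist v w) / k * exp (k * \<tau>))"
      by (simp del: times_divide_eq_left times_divide_eq_right)
    also have "\<dots> = L / k * dist v w"
      by (simp add: exp_minus)
    finally show "dist (apply_bcontfun (T v) t) (apply_bcontfun (T w) t) \<le> L / k * dist v w"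
      by (simp add: T dist_norm)
  qed
  have "\<exists>!v. T v = v"
    using L k contraction by (intro banach_fix_type[where c = "L / k"]) (auto simp: k_def)
  then obtain v where v: "T v = v" by blast
  define u where "u t = exp (k * t) *\<^sub>R apply_bcontfun v t" for t
  have \<phi>_u: "\<phi> v s = g (u s)" for s
    by (simp add: \<phi>_def u_def)
  have u: "u t = z0 + integral {0..t} (\<phi> v)" if "0 \<le> t" for t
  proof -
    have "apply_bcontfun v t = \<Phi> v t"
      using v T by metis
    then show ?thesis
      using that by (simp add: u_def \<Phi>_def flip: exp_add)
  qed
  have "(u has_vector_derivative g (u t)) (at t within {0..})" if "0 \<le> t" for t
  proof -
    have "((\<lambda>t. z0 + integral {0..t} (\<phi> v)) has_vector_derivative g (u t)) (at t within {0..})"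
      using that integral_has_vector_derivative_atLeast[OF \<phi>_cont[of _ v] that]
      by (auto intro!: derivative_eq_intros simp: \<phi>_u)
    then show ?thesis
      by (rule has_vector_derivative_transform[rotated 2]) (use that u in auto)
  qed
  moreover have "u 0 = z0" by (simp add: u)
  ultimately show ?thesis by (auto simp: is_solution_def)
qed

section \<open>Global solutions for vector fields tangent to spheres\<close>

text \<open>Because the projection is a positive rescaling, orthogonality of \<open>f (c x)\<close>
  to \<open>c x\<close> carries over to x. Outside the ball, the triangle inequality identifies the
  nearest point.\<close>

lemma closest_point_cball_0:
  fixes x :: "'a::euclidean_space"
  assumes "0 < R"
  shows "\<exists>c>0. closest_point (cball 0 R) x = c *\<^sub>R x"
proof (cases "norm x \<le> R")
  case True
  then show ?thesis
    by (intro exI[of _ 1]) (auto intro: closest_point_self)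
next
  case False
  then have x: "norm x > 0" using assms by linarith
  have "dist x ((R / norm x) *\<^sub>R x) \<le> dist x y" if "y \<in> cball 0 R" for y
  proof -
    have "x - (R / norm x) *\<^sub>R x = (1 - R / norm x) *\<^sub>R x"
      by (simp add: algebra_simps)
    then have "dist x ((R / norm x) *\<^sub>R x) = \<bar>1 - R / norm x\<bar> * norm x"
      by (simp add: dist_norm)
    also have "\<dots> = norm x - R"
      using False x by (simp add: field_simps)
    also have "\<dots> \<le> dist x y"
      using that norm_triangle_sub[of x y] by (simp add: dist_norm)
    finally show ?thesis .
  qed
  then have "(R / norm x) *\<^sub>R x = closest_point (cball 0 R) x"
    using assms x by (intro closest_point_unique) auto
  then show ?thesis
    using assms x by (intro exI[of _ "R / norm x"]) auto
qed

lemma has_vector_derivative_bilinear_diag: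
  assumes "bounded_bilinear B" and "\<And>v w. B v w = B w v"
    and "(u has_vector_derivative u') (at t within S)"
  shows "((\<lambda>t. B (u t) (u t)) has_vector_derivative 2 *\<^sub>R B (u t) u') (at t within S)"
  using bounded_bilinear.has_vector_derivative[OF assms(1,3,3)] assms(2)[of u' "u t"]
  by (simp add: scaleR_2)

text \<open>Replacing \<open>f\<close> by its composition with the radial retraction onto a ball makes it globally
  Lipschitz and keeps it orthogonal to the radius, so that solutions never leave the ball.\<close>

lemma norm_preserving_global_solution:
  fixes f :: "'a::euclidean_space \<Rightarrow> 'a"
  assumes lip: "\<And>R. \<exists>L. L-lipschitz_on (cball 0 R) f" and orth: "\<And>p. p \<bullet> f p = 0"
  shows "\<exists>u. is_solution f {0..} u \<and> u 0 = z0"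
proof -
  define R where "R = norm z0 + 1"
  have R: "0 < R" by (simp add: R_def add_nonneg_pos)
  define c where "c = closest_point (cball (0::'a) R)"
  obtain L where L: "L-lipschitz_on (cball 0 R) f" using lip by blast
  have c_in: "c x \<in> cball 0 R" for x
    unfolding c_def using R by (intro closest_point_in_set) auto
  have "1-lipschitz_on UNIV c"
    using R by (auto intro!: lipschitz_onI closest_point_lipschitz simp: c_def)
  moreover have "L-lipschitz_on (range c) f"
    using L by (rule lipschitz_on_subset) (use c_in in auto)
  ultimately have "(L * 1)-lipschitz_on UNIV (f \<circ> c)"
    by (rule lipschitz_on_compose)
  then obtain u where sol: "is_solution (f \<circ> c) {0..} u" and u0: "u 0 = z0"
    using lipschitz_global_solution by blast
  have orth': "x \<bullet> f (c x) = 0" for x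
  proof -
    obtain r where "r > 0" "c x = r *\<^sub>R x"
      using closest_point_cball_0[OF R, of x] by (auto simp: c_def)
    then show ?thesis using orth[of "c x"] by simp
  qed
  have u': "(u has_vector_derivative f (c (u t))) (at t within {0..})" if "t \<ge> 0" for t
    using sol that by (auto simp: is_solution_def)
  have "((\<lambda>t. u t \<bullet> u t) has_vector_derivative 0) (at t within {0..})" if "t \<in> {0..}" for t
    using has_vector_derivative_bilinear_diag[OF bounded_bilinear_inner inner_commute u'[of t]]
      that orth' by simp
  then obtain C where "\<And>t. t \<ge> 0 \<Longrightarrow> u t \<bullet> u t = C"
    using has_vector_derivative_zero_constant[of "{0..}"] by (metis atLeast_iff convex_real_interval(1))
  then have "norm (u t) = norm z0" if "t \<ge> 0" for t
    using that u0 by (metis norm_eq_sqrt_inner order_refl)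
  then have "c (u t) = u t" if "t \<ge> 0" for t
    using that by (auto simp: c_def R_def intro!: closest_point_self)
  then show ?thesis
    using u' u0 by (auto simp: is_solution_def)
qed

lemma quadratic_lipschitz_on_cball:
  assumes B: "bounded_bilinear B"
  shows "\<exists>L. L-lipschitz_on (cball 0 R) (\<lambda>p. B p p)"
proof -
  interpret bounded_bilinear B by fact
  obtain K where K: "K \<ge> 0" "\<And>a b. norm (B a b) \<le> norm a * norm b * K"
    using nonneg_bounded by blast
  have "(2 * \<bar>R\<bar> * K)-lipschitz_on (cball 0 R) (\<lambda>p. B p p)"
  proof (rule lipschitz_onI)
    fix p q :: 'a
    assume pq: "p \<in> cball 0 R" "q \<in> cball 0 R"
    have "norm (B p p - B q q) = norm (B (p - q) p + B q (p - q))"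
      by (simp add: diff_left diff_right)
    also have "\<dots> \<le> norm (p - q) * norm p * K + norm q * norm (p - q) * K"
      by (intro norm_triangle_mono K)
    also have "\<dots> \<le> norm (p - q) * \<bar>R\<bar> * K + \<bar>R\<bar> * norm (p - q) * K"
      using pq K(1) by (intro add_mono mult_right_mono mult_left_mono) auto
    finally show "dist (B p p) (B q q) \<le> 2 * \<bar>R\<bar> * K * dist p q"
      by (simp add: dist_norm algebra_simps)
  qed (use K(1) in auto)
  then show ?thesis by blast
qed

section \<open>Stability from an isolated joint level set\<close>

text \<open>A barrier argument: isolation gives the deviation of H from \<open>H z\<close> a
  positive minimum on a small sphere around z. A solution starting near z carries a smaller
  deviation, which is constant in time, so it cannot cross the sphere. Values in a metric space
  allow several constants of motion to be used jointly.\<close>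

lemma lyapunov_stable_isolated_level:
  fixes f :: "'a::euclidean_space \<Rightarrow> 'a" and H :: "'a \<Rightarrow> 'b::metric_space"
  assumes eq: "f z = 0"
    and global: "\<And>z0. \<exists>u. is_solution f {0..} u \<and> u 0 = z0"
    and cont: "continuous_on UNIV H"
    and conserved: "\<And>T u t. is_solution f {0..<T} u \<Longrightarrow> t \<in> {0..<T} \<Longrightarrow> H (u t) = H (u 0)"
    and isolated: "r > 0" "\<And>p. dist p z \<le> r \<Longrightarrow> H p = H z \<Longrightarrow> p = z"
  shows "lyapunov_stable f z"
  unfolding lyapunov_stable_def
proof (intro conjI allI impI eq)
  fix \<epsilon> :: real assume \<epsilon>: "\<epsilon> > 0"
  \<comment> \<open>The sphere of radius \<rho> lies both in the closed target ball and where z is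
    isolated.\<close>
  define \<rho> where "\<rho> = min \<epsilon> r"
  have \<rho>: "0 < \<rho>" "\<rho> \<le> \<epsilon>" "\<rho> \<le> r" using \<epsilon> isolated(1) by (auto simp: \<rho>_def)
  define V where "V p = dist (H p) (H z)" for p
  have V_cont: "continuous_on S V" for S
    unfolding V_def by (intro continuous_intros continuous_on_subset[OF cont]) auto
  obtain x where "x \<in> sphere z \<rho>" and x_min: "\<And>p. p \<in> sphere z \<rho> \<Longrightarrow> V x \<le> V p"
    using continuous_attains_inf[OF compact_sphere _ V_cont, of z \<rho>] \<rho> by force
  then have "V x > 0"
    using isolated(2)[of x] \<rho> by (auto simp: V_def dist_commute)
  moreover have "(V \<longlongrightarrow> V z) (at z)"
    using V_cont[of UNIV] by (simp add: continuous_on_def)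
  ultimately have "eventually (\<lambda>p. V p < V x) (at z)"
    by (intro order_tendstoD(2)[of V "V z"]) (auto simp: V_def)
  then obtain d where d: "d > 0" "\<And>p. p \<noteq> z \<Longrightarrow> dist p z < d \<Longrightarrow> V p < V x"
    by (auto simp: eventually_at)
  have small: "V p < V x" if "dist p z < d" for p
    using that d \<open>V x > 0\<close> by (cases "p = z") (auto simp: V_def)
  show "\<exists>\<delta>>0. \<forall>z0. dist z0 z < \<delta> \<longrightarrow>
        (\<exists>u. is_solution f {0..} u \<and> u 0 = z0) \<and>
        (\<forall>T>0. \<forall>u. is_solution f {0..<T} u \<and> u 0 = z0 \<longrightarrow> (\<forall>t\<in>{0..<T}. dist (u t) z < \<epsilon>))"
  proof (intro exI[of _ "min d \<rho>"] conjI allI impI ballI global)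
    show "min d \<rho> > 0" using d \<rho> by simp
    fix z0 T u t
    assume z0: "dist z0 z < min d \<rho>" and u: "is_solution f {0..<T} u \<and> u 0 = z0"
      and t: "t \<in> {0..<T}"
    show "dist (u t) z < \<epsilon>"
    proof (rule ccontr)
      assume "\<not> dist (u t) z < \<epsilon>"
      moreover have "continuous_on {0..t} (\<lambda>t. dist (u t) z)"
      proof (intro continuous_intros)
        have "continuous_on {0..<T} u"
          using u unfolding is_solution_def continuous_on_eq_continuous_within
          by (auto intro: has_vector_derivative_continuous)
        then show "continuous_on {0..t} u"
          by (rule continuous_on_subset) (use t in auto)
      qed
      \<comment> \<open>The solution starts inside the sphere and is at distance at least \<epsilon>
        \<ge> \<rho> at time t, so it meets the sphere in between.\<close>
      ultimately obtain s where s: "0 \<le> s" "s \<le> t" "dist (u s) z = \<rho>"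
        using IVT'[of "\<lambda>t. dist (u t) z" 0 \<rho> t] u z0 t \<rho> by force
      then have "V (u s) = V z0"
        using conserved[of T u s] u t by (simp add: V_def)
      moreover have "V x \<le> V (u s)"
        using s by (intro x_min) (simp add: dist_commute)
      ultimately show False using small[of z0] z0 by simp
    qed
  qed
qed

text \<open>If the level set accumulated at \<open>z\<close>, a limiting direction \<open>d\<close> of the points of the level
  set would be tangent to the levels of \<open>A\<close> and \<open>B\<close> and satisfy \<open>Q d d = 0\<close>, because \<open>z\<close> lies in
  the radical of \<open>Q\<close>.\<close>

lemma quadratic_level_isolated:
  fixes A B Q :: "'a::euclidean_space \<Rightarrow> 'a \<Rightarrow> real"
  assumes bil: "bounded_bilinear A" "bounded_bilinear B" "bounded_bilinear Q"
    and sym: "\<And>v w. A v w = A w v" "\<And>v w. B v w = B w v" "\<And>v w. Q v w = Q w v"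
    and crit: "\<And>v. Q z v = 0"
    and definite: "\<And>v. A z v = 0 \<Longrightarrow> B z v = 0 \<Longrightarrow> Q v v = 0 \<Longrightarrow> v = 0"
  shows "\<exists>r>0. \<forall>p. dist p z \<le> r \<longrightarrow> A p p = A z z \<longrightarrow> B p p = B z z \<longrightarrow> Q p p = Q z z \<longrightarrow> p = z"
proof (rule ccontr)
  assume neg: "\<not> ?thesis"
  have "\<exists>p. dist p z \<le> 1 / Suc n \<and> A p p = A z z \<and> B p p = B z z \<and> Q p p = Q z z \<and> p \<noteq> z" for n
    using neg by (force dest: spec[of _ "1 / Suc n"])
  then obtain p where p: "\<And>n. dist (p n) z \<le> 1 / Suc n" "\<And>n. A (p n) (p n) = A z z"
    "\<And>n. B (p n) (p n) = B z z" "\<And>n. Q (p n) (p n) = Q z z" "\<And>n. p n \<noteq> z"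
    by metis
  define s where "s n = norm (p n - z)" for n
  define d where "d n = (p n - z) /\<^sub>R s n" for n
  have s_pos: "s n > 0" for n using p(5) by (simp add: s_def)
  have p_eq: "p n = z + s n *\<^sub>R d n" for n using s_pos[of n] by (simp add: d_def)
  have s0: "s \<longlonglongrightarrow> 0"
  proof (rule real_tendsto_sandwich[where f = "\<lambda>_. 0" and h = "\<lambda>n. inverse (real (Suc n))"])
    show "(\<lambda>n. inverse (real (Suc n))) \<longlonglongrightarrow> 0"
      by (rule LIMSEQ_inverse_real_of_nat)
    show "\<forall>\<^sub>F n in sequentially. s n \<le> inverse (real (Suc n))"
      using p(1) by (simp add: s_def dist_norm inverse_eq_divide)
  qed (auto simp: s_def)
  have "d n \<in> sphere 0 1" for n
    using s_pos[of n] by (simp add: d_def s_def)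
  then obtain e \<sigma> where e: "e \<in> sphere 0 1" and \<sigma>: "strict_mono \<sigma>" "(d \<circ> \<sigma>) \<longlonglongrightarrow> e"
    using compact_sphere[of "0::'a" 1] unfolding compact_eq_seq_compact_metric seq_compact_def
    by metis
  have d_lim: "(\<lambda>n. d (\<sigma> n)) \<longlonglongrightarrow> e" and s_lim: "(\<lambda>n. s (\<sigma> n)) \<longlonglongrightarrow> 0"
    using \<sigma> LIMSEQ_subseq_LIMSEQ[OF s0 \<sigma>(1)] by (auto simp: o_def)
  \<comment> \<open>The exact Taylor expansion at z. After division by \<open>s n\<close>, only the
    linear term survives in the limit.\<close>
  have expand: "F (p n) (p n) - F z z = s n * (2 * F z (d n) + s n * F (d n) (d n))"
    if "bounded_bilinear F" "\<And>v w. F v w = F w v" for F :: "'a \<Rightarrow> 'a \<Rightarrow> real" and n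
  proof -
    interpret bounded_bilinear F by fact
    show ?thesis
      using that(2)[of "d n" z]
      by (simp add: p_eq add_left add_right scaleR_left scaleR_right algebra_simps)
  qed
  have tangent: "F z e = 0"
    if F: "bounded_bilinear F" "\<And>v w. F v w = F w v" "\<And>n. F (p n) (p n) = F z z"
    for F :: "'a \<Rightarrow> 'a \<Rightarrow> real"
  proof -
    interpret bounded_bilinear F by fact
    have "2 * F z (d n) + s n * F (d n) (d n) = 0" for n
      using expand[OF F(1,2), of n] F(3) s_pos[of n] by simp
    moreover have "(\<lambda>n. 2 * F z (d (\<sigma> n)) + s (\<sigma> n) * F (d (\<sigma> n)) (d (\<sigma> n)))
        \<longlonglongrightarrow> 2 * F z e + 0 * F e e"
      by (intro tendsto_intros tendsto d_lim s_lim)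
    ultimately show ?thesis
      by (simp add: LIMSEQ_const_iff)
  qed
  \<comment> \<open>For Q the linear term vanishes by \<open>crit\<close>, so the quadratic term is
    zero already before the limit is taken.\<close>
  have "Q (d n) (d n) = 0" for n
    using expand[OF bil(3) sym(3), of n] p(4) crit s_pos[of n] by simp
  moreover have "(\<lambda>n. Q (d (\<sigma> n)) (d (\<sigma> n))) \<longlonglongrightarrow> Q e e"
    by (intro bounded_bilinear.tendsto[OF bil(3)] d_lim)
  ultimately have "Q e e = 0"
    by (simp add: LIMSEQ_const_iff)
  then have "e = 0"
    using definite tangent bil sym p by metis
  then show False using e by simp
qed

section \<open>Derivatives and conservation of quadratic forms\<close>

lemma frechet_derivative_quadratic:
  assumes "bounded_bilinear B" and "\<And>v w. B v w = B w v"
  shows "frechet_derivative (\<lambda>p. B p p / 2 :: real) (at z) = B z"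
proof -
  have "((\<lambda>p. B p p) has_derivative (\<lambda>h. B z h + B h z)) (at z)"
    by (rule bounded_bilinear.FDERIV[OF assms(1) has_derivative_ident has_derivative_ident])
  then have "((\<lambda>p. B p p / 2) has_derivative B z) (at z)"
    using assms(2) by (auto intro!: derivative_eq_intros)
  then show ?thesis
    by (rule frechet_derivative_at[symmetric])
qed

lemma hessian_quadratic:
  assumes "bounded_bilinear B" and "\<And>v w. B v w = B w v"
  shows "hessian (\<lambda>p. B p p / 2 :: real) z = B"
proof (intro ext)
  fix v w
  have "((\<lambda>p. B p w) has_derivative (\<lambda>v. B v w)) (at z)"
    by (intro bounded_linear_imp_has_derivative bounded_bilinear.bounded_linear_left assms)
  then show "hessian (\<lambda>p. B p p / 2) z v w = B v w"
    unfolding hessian_def frechet_derivative_quadratic[OF assms]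
    by (simp flip: frechet_derivative_at)
qed

lemma conserved_quadratic:
  fixes B :: "'a::real_normed_vector \<Rightarrow> 'a \<Rightarrow> real"
  assumes B: "bounded_bilinear B" "\<And>v w. B v w = B w v" and orth: "\<And>p. B p (f p) = 0"
    and sol: "is_solution f I u" and I: "convex I" "s \<in> I" "t \<in> I"
  shows "B (u s) (u s) = B (u t) (u t)"
proof -
  have "((\<lambda>t. B (u t) (u t)) has_vector_derivative 0) (at t within I)" if "t \<in> I" for t
    using has_vector_derivative_bilinear_diag[OF B, of u "f (u t)" t I] sol that orth
    by (simp add: is_solution_def)
  then obtain C where "\<And>t. t \<in> I \<Longrightarrow> B (u t) (u t) = C"
    using has_vector_derivative_zero_constant[OF I(1), of "\<lambda>t. B (u t) (u t)"] by blast
  then show ?thesis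
    using I by simp
qed

section \<open>The rigid body field and the quadratic forms adapted to it\<close>

text \<open>A bilinear map, not symmetric, with the vector field on its diagonal. Bilinearity gives
  the Lipschitz bounds on balls that global existence needs.\<close>

definition rigid_body_polar :: "real^4 \<Rightarrow> so4 \<Rightarrow> so4 \<Rightarrow> so4" where
  "rigid_body_polar l = (\<lambda>(x, y) (x', y').
     (vector
       [(1 / lam2 l 1 2 - 1 / lam2 l 1 3) * x$2 * x'$3 + (1 / lam2 l 3 4 - 1 / lam2 l 2 4) * y$2 * y'$3,
        (1 / lam2 l 2 3 - 1 / lam2 l 1 2) * x$1 * x'$3 + (1 / lam2 l 1 4 - 1 / lam2 l 3 4) * y$1 * y'$3,
        (1 / lam2 l 1 3 - 1 / lam2 l 2 3) * x$1 * x'$2 + (1 / lam2 l 2 4 - 1 / lam2 l 1 4) * y$1 * y'$2],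
      vector
       [(1 / lam2 l 3 4 - 1 / lam2 l 1 3) * x$2 * y'$3 + (1 / lam2 l 1 2 - 1 / lam2 l 2 4) * x$3 * y'$2,
        (1 / lam2 l 2 3 - 1 / lam2 l 3 4) * x$1 * y'$3 + (1 / lam2 l 1 4 - 1 / lam2 l 1 2) * x$3 * y'$1,
        (1 / lam2 l 2 4 - 1 / lam2 l 2 3) * x$1 * y'$2 + (1 / lam2 l 1 3 - 1 / lam2 l 1 4) * x$2 * y'$1]))"

lemma rigid_body_eq_polar: "rigid_body l p = rigid_body_polar l p p"
  by (simp add: rigid_body_def rigid_body_polar_def split: prod.split)

lemma bounded_bilinear_rigid_body_polar: "bounded_bilinear (rigid_body_polar l)"
  unfolding bilinear_conv_bounded_bilinear[symmetric] bilinear_def linear_iff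
  by (auto simp: rigid_body_polar_def vec_eq_iff forall_3 distrib_left distrib_right
      mult.assoc mult.left_commute)

text \<open>On each pair \<open>(x$i, y$i)\<close> this is the symmetric block with diagonal
  \<open>g$i + m\<close>, \<open>h$i + m\<close> and off-diagonal entry n. The vectors g and h
  encode G, while m and n are the multipliers of the Casimirs.\<close>

definition diag_form :: "real^3 \<Rightarrow> real^3 \<Rightarrow> real \<Rightarrow> real \<Rightarrow> so4 \<Rightarrow> so4 \<Rightarrow> real" where
  "diag_form g h m n = (\<lambda>(x, y) (x', y'). \<Sum>i\<in>UNIV.
     (g$i + m) * (x$i * x'$i) + (h$i + m) * (y$i * y'$i) + n * (x$i * y'$i + y$i * x'$i))"

lemma bounded_bilinear_diag_form: "bounded_bilinear (diag_form g h m n)"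
  unfolding bilinear_conv_bounded_bilinear[symmetric] bilinear_def linear_iff
  by (auto simp: diag_form_def sum_3 algebra_simps)

lemma diag_form_sym: "diag_form g h m n v w = diag_form g h m n w v"
  by (simp add: diag_form_def mult.commute add.commute split: prod.split)

lemma diag_form_split:
  "diag_form g h m n v w =
     diag_form g h 0 0 v w + m * diag_form 0 0 1 0 v w + n * diag_form 0 0 0 1 v w"
  by (simp add: diag_form_def sum_3 algebra_simps split: prod.split)

lemma diag_form_Casimir:
  shows "C1 p = diag_form 0 0 1 0 p p / 2" and "C2 p = diag_form 0 0 0 1 p p / 2"
  by (simp_all add: C1_def C2_def diag_form_def sum_3 power2_eq_square field_simps split: prod.split)

lemma rigid_body_Casimir:
  shows "diag_form 0 0 1 0 p (rigid_body l p) = 0" and "diag_form 0 0 0 1 p (rigid_body l p) = 0"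
  by (simp_all add: diag_form_def sum_3 rigid_body_def algebra_simps split: prod.split)

lemma rigid_body_global_solution: "\<exists>u. is_solution (rigid_body l) {0..} u \<and> u 0 = z0"
proof (rule norm_preserving_global_solution)
  show "\<exists>L. L-lipschitz_on (cball 0 R) (rigid_body l)" for R
    using quadratic_lipschitz_on_cball[OF bounded_bilinear_rigid_body_polar]
    by (simp flip: rigid_body_eq_polar)
  have "v \<bullet> w = diag_form 0 0 1 0 v w" for v w
    by (simp add: diag_form_def inner_prod_def inner_vec_def sum.distrib split: prod.split)
  then show "p \<bullet> rigid_body l p = 0" for p
    by (simp add: rigid_body_Casimir)
qed

section \<open>A stability criterion for equilibria on a coordinate plane\<close>

lemma rigid_body_axis: "rigid_body l (axis k \<alpha>, axis k \<beta>) = 0"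
  using exhaust_3[of k]
  by (auto simp: rigid_body_def axis_def vec_eq_iff forall_3 prod_eq_iff)

text \<open>The two coefficients are the k-th block applied to (\<alpha>, \<beta>). Their vanishing
  expresses criticality; for the Casimirs the same formula describes the kernels of the
  differentials.\<close>

lemma diag_form_axis:
  "diag_form g h m n (axis k \<alpha>, axis k \<beta>) v =
     ((g$k + m) * \<alpha> + n * \<beta>) * fst v $ k + (n * \<alpha> + (h$k + m) * \<beta>) * snd v $ k"
  using exhaust_3[of k]
  by (auto simp: diag_form_def sum_3 axis_def algebra_simps split: prod.split)

text \<open>The multipliers solve the two linear equations expressing that the equilibrium is critical.\<close>

lemma Casimir_multipliers:
  fixes g h \<alpha> \<beta> :: real
  assumes "(h = 0 \<and> \<beta>\<^sup>2 < \<alpha>\<^sup>2) \<or> (g = 0 \<and> \<alpha>\<^sup>2 < \<beta>\<^sup>2)"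
  shows "\<exists>m n \<rho>. (g + m) * \<alpha> + n * \<beta> = 0 \<and> n * \<alpha> + (h + m) * \<beta> = 0 \<and>
    m\<^sup>2 + m * (g + h) = n\<^sup>2 \<and> 0 < \<rho> \<and> m = - \<rho> * (g + h)"
  using assms
proof (elim disjE conjE)
  assume "h = 0" and lt: "\<beta>\<^sup>2 < \<alpha>\<^sup>2"
  \<comment> \<open>Eliminating n gives \<open>m * (\<alpha>\<^sup>2 - \<beta>\<^sup>2) = - g *
    \<alpha>\<^sup>2\<close>, whence \<open>m = - (t * \<alpha>\<^sup>2) * g\<close>,
    \<open>n = t * g * \<alpha> * \<beta>\<close> and \<open>\<rho> = t * \<alpha>\<^sup>2\<close>.
    The third identity below says that the block at k is singular, as (\<alpha>, \<beta>) is a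
    nonzero vector in its kernel.\<close>
  define t where "t = 1 / (\<alpha>\<^sup>2 - \<beta>\<^sup>2)"
  have t: "t * (\<alpha>\<^sup>2 - \<beta>\<^sup>2) = 1" "0 < t" using lt by (simp_all add: t_def)
  have "0 < \<alpha>\<^sup>2" using lt zero_le_power2[of \<beta>] by linarith
  then have "0 < t * \<alpha>\<^sup>2" using t(2) by simp
  moreover have "(g + - (t * \<alpha>\<^sup>2) * g) * \<alpha> + (t * g * \<alpha> * \<beta>) * \<beta> = 0"
    "(t * g * \<alpha> * \<beta>) * \<alpha> + (- (t * \<alpha>\<^sup>2) * g) * \<beta> = 0"
    "(- (t * \<alpha>\<^sup>2) * g)\<^sup>2 + (- (t * \<alpha>\<^sup>2) * g) * g = (t * g * \<alpha> * \<beta>)\<^sup>2"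
    using t(1) by - algebra+
  ultimately show ?thesis
    unfolding \<open>h = 0\<close> add_0 add_0_right by blast
next
  assume "g = 0" and lt: "\<alpha>\<^sup>2 < \<beta>\<^sup>2"
  define t where "t = 1 / (\<beta>\<^sup>2 - \<alpha>\<^sup>2)"
  have t: "t * (\<beta>\<^sup>2 - \<alpha>\<^sup>2) = 1" "0 < t" using lt by (simp_all add: t_def)
  have "0 < \<beta>\<^sup>2" using lt zero_le_power2[of \<alpha>] by linarith
  then have "0 < t * \<beta>\<^sup>2" using t(2) by simp
  moreover have "(t * h * \<alpha> * \<beta>) * \<alpha> + (h + - (t * \<beta>\<^sup>2) * h) * \<beta> = 0"
    "(- (t * \<beta>\<^sup>2) * h) * \<alpha> + (t * h * \<alpha> * \<beta>) * \<beta> = 0"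
    "(- (t * \<beta>\<^sup>2) * h)\<^sup>2 + (- (t * \<beta>\<^sup>2) * h) * h = (t * h * \<alpha> * \<beta>)\<^sup>2"
    using t(1) by - algebra+
  ultimately show ?thesis
    unfolding \<open>g = 0\<close> add_0 add_0_right by blast
qed

text \<open>As \<open>g * h = 0\<close>, one diagonal entry is m itself and \<open>det\<close> says
  that the determinant is positive. Multiplying by m and completing the square leaves a square plus
  the determinant times a square, so the form has the sign of m.\<close>

lemma binary_form_definite:
  fixes g h m n x y :: real
  assumes "g * h = 0" and det: "n\<^sup>2 < m\<^sup>2 + m * (g + h)" and "x \<noteq> 0 \<or> y \<noteq> 0"
  shows "0 < m * ((g + m) * (x * x) + (h + m) * (y * y) + n * (x * y + y * x))"
proof -
  have m: "m \<noteq> 0" using det zero_le_power2[of n] by auto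
  define \<Delta> where "\<Delta> = m\<^sup>2 + m * (g + h) - n\<^sup>2"
  have \<Delta>: "\<Delta> > 0" using det by (simp add: \<Delta>_def)
  consider "g = 0" | "h = 0" using assms(1) by auto
  then show ?thesis
  proof cases
    case 1
    then have "m * ((g + m) * (x * x) + (h + m) * (y * y) + n * (x * y + y * x))
        = (m * x + n * y)\<^sup>2 + \<Delta> * y\<^sup>2"
      by (simp add: \<Delta>_def power2_eq_square algebra_simps)
    also have "\<dots> > 0"
      using \<Delta> m assms(3) by (cases "y = 0") (auto intro: add_nonneg_pos)
    finally show ?thesis .
  next
    case 2
    then have "m * ((g + m) * (x * x) + (h + m) * (y * y) + n * (x * y + y * x))
        = (m * y + n * x)\<^sup>2 + \<Delta> * x\<^sup>2"
      by (simp add: \<Delta>_def power2_eq_square algebra_simps)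
    also have "\<dots> > 0"
      using \<Delta> m assms(3) by (cases "x = 0") (auto intro: add_nonneg_pos)
    finally show ?thesis .
  qed
qed

text \<open>Criticality makes the block at k singular, and \<open>gap\<close> makes every other
  block have positive determinant. These blocks all share the sign of m, so their sum is definite
  where the k-th components vanish.\<close>

lemma nonlinearly_stable_axis:
  fixes g h :: "real^3" and k :: 3 and \<alpha> \<beta> :: real
  assumes G: "\<And>p. G p = diag_form g h 0 0 p p / 2"
    and conserved: "\<And>p. diag_form g h 0 0 p (rigid_body l p) = 0"
    and gh: "\<And>i. g$i * h$i = 0"
    and gap: "\<And>i. i \<noteq> k \<Longrightarrow> 0 < (g$k + h$k) * ((g$k + h$k) - (g$i + h$i))"
    and regular: "(h$k = 0 \<and> \<beta>\<^sup>2 < \<alpha>\<^sup>2) \<or> (g$k = 0 \<and> \<alpha>\<^sup>2 < \<beta>\<^sup>2)"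
  shows "nonlinearly_stable_with l G (axis k \<alpha>, axis k \<beta>)"
proof -
  define z :: so4 where "z = (axis k \<alpha>, axis k \<beta>)"
  obtain m n \<rho> where crit: "(g$k + m) * \<alpha> + n * \<beta> = 0" "n * \<alpha> + (h$k + m) * \<beta> = 0"
    and mn: "m\<^sup>2 + m * (g$k + h$k) = n\<^sup>2" and \<rho>: "0 < \<rho>" "m = - \<rho> * (g$k + h$k)"
    using Casimir_multipliers[OF regular] by blast
  define Q where "Q = diag_form g h m n"
  have Q: "bounded_bilinear Q" "\<And>v w. Q v w = Q w v"
    unfolding Q_def by (rule bounded_bilinear_diag_form diag_form_sym)+
  have Q_z: "Q z = (\<lambda>_. 0)"
    using crit by (intro ext) (simp add: Q_def z_def diag_form_axis)
  \<comment> \<open>Subtracting the zero determinant at k leaves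
    \<open>m * ((g$i + h$i) - (g$k + h$k))\<close>, in which m is a negative multiple of
    \<open>g$k + h$k\<close>.\<close>
  have det: "n\<^sup>2 < m\<^sup>2 + m * (g$i + h$i)" if "i \<noteq> k" for i
  proof -
    have "m\<^sup>2 + m * (g$i + h$i) - n\<^sup>2 = \<rho> * ((g$k + h$k) * ((g$k + h$k) - (g$i + h$i)))"
      unfolding mn[symmetric] \<rho>(2) by (simp add: algebra_simps)
    also have "\<dots> > 0"
      using gap[OF that] \<rho>(1) by simp
    finally show ?thesis by simp
  qed
  have pos: "0 < m * Q v v"
    if v: "diag_form 0 0 1 0 z v = 0" "diag_form 0 0 0 1 z v = 0" "v \<noteq> 0" for v
  proof -
    obtain x y where xy: "v = (x, y)" by (cases v)
    have e: "\<alpha> * x$k + \<beta> * y$k = 0" "\<beta> * x$k + \<alpha> * y$k = 0"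
      using v(1,2) by (simp_all add: z_def diag_form_axis xy)
    \<comment> \<open>The system has determinant \<open>\<alpha>\<^sup>2 - \<beta>\<^sup>2\<close>,
      nonzero by \<open>regular\<close>; thus v has no component at k, where Q degenerates.\<close>
    then have "(\<alpha>\<^sup>2 - \<beta>\<^sup>2) * x$k = 0" "(\<alpha>\<^sup>2 - \<beta>\<^sup>2) * y$k = 0"
      by - algebra+
    then have k0: "x$k = 0" "y$k = 0"
      using regular by auto
    define q where "q i = m * ((g$i + m) * (x$i * x$i) + (h$i + m) * (y$i * y$i)
      + n * (x$i * y$i + y$i * x$i))" for i
    have q_pos: "0 < q i" if "x$i \<noteq> 0 \<or> y$i \<noteq> 0" for i
      unfolding q_def using that k0 by (intro binary_form_definite gh det) auto
    have "0 \<le> q i" for i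
      using q_pos[of i] by (cases "x$i = 0 \<and> y$i = 0") (auto simp: q_def)
    moreover obtain j where "x$j \<noteq> 0 \<or> y$j \<noteq> 0"
      using v(3) by (auto simp: xy vec_eq_iff prod_eq_iff)
    ultimately have "0 < sum q UNIV"
      using q_pos by (intro sum_pos2[of _ j]) auto
    then show ?thesis
      by (simp add: Q_def diag_form_def xy q_def sum_distrib_left)
  qed
  have F: "(\<lambda>p. G p + m * C1 p + n * C2 p) = (\<lambda>p. Q p p / 2)"
    by (simp add: fun_eq_iff G diag_form_Casimir Q_def diag_form_split[of g h m n] add_divide_distrib)
  have C: "C1 = (\<lambda>p. diag_form 0 0 1 0 p p / 2)" "C2 = (\<lambda>p. diag_form 0 0 0 1 p p / 2)"
    by (simp_all add: fun_eq_iff diag_form_Casimir)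
  have kernel: "casimir_kernel z = {v. diag_form 0 0 1 0 z v = 0} \<inter> {v. diag_form 0 0 0 1 z v = 0}"
    unfolding casimir_kernel_def C
    by (simp add: frechet_derivative_quadratic bounded_bilinear_diag_form diag_form_sym)
  have "definite_on (casimir_kernel z) Q"
    using pos by (cases "m > 0") (auto simp: definite_on_def kernel zero_less_mult_iff)
  moreover have "frechet_derivative (\<lambda>p. Q p p / 2) (at z) = (\<lambda>_. 0)"
    by (simp add: frechet_derivative_quadratic Q Q_z)
  moreover have "lyapunov_stable (rigid_body l) z"
  proof -
    define H where "H p = (diag_form 0 0 1 0 p p, diag_form 0 0 0 1 p p, Q p p)" for p
    have "\<exists>r>0. \<forall>p. dist p z \<le> r \<longrightarrow> diag_form 0 0 1 0 p p = diag_form 0 0 1 0 z z \<longrightarrow>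
        diag_form 0 0 0 1 p p = diag_form 0 0 0 1 z z \<longrightarrow> Q p p = Q z z \<longrightarrow> p = z"
      using pos
      by (intro quadratic_level_isolated bounded_bilinear_diag_form diag_form_sym Q)
        (fastforce simp: Q_z)+
    then obtain r where r: "r > 0" "\<And>p. dist p z \<le> r \<Longrightarrow> H p = H z \<Longrightarrow> p = z"
      by (auto simp: H_def)
    show ?thesis
    proof (rule lyapunov_stable_isolated_level[where H = H, OF _ _ _ _ r])
      show "rigid_body l z = 0" by (simp add: z_def rigid_body_axis)
      show "continuous_on UNIV H"
        unfolding H_def Q_def
        by (intro continuous_intros bounded_bilinear.continuous_on[OF bounded_bilinear_diag_form])
      have "Q p (rigid_body l p) = 0" for p
        by (simp add: Q_def diag_form_split[of g h m n] conserved rigid_body_Casimir)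
      note orth = rigid_body_Casimir this
      show "H (u t) = H (u 0)" if u: "is_solution (rigid_body l) {0..<T} u" and t: "t \<in> {0..<T}" for T u t
      proof -
        have I: "convex {0..<T}" "t \<in> {0..<T}" "0 \<in> {0..<T}" using t by auto
        show ?thesis
          unfolding H_def
            conserved_quadratic[OF bounded_bilinear_diag_form diag_form_sym orth(1) u I]
            conserved_quadratic[OF bounded_bilinear_diag_form diag_form_sym orth(2) u I]
            conserved_quadratic[OF Q orth(3) u I] ..
      qed
    qed (rule rigid_body_global_solution)
  qed
  ultimately show ?thesis
    unfolding nonlinearly_stable_with_def Let_def z_def[symmetric]
    by (intro conjI exI[of _ m] exI[of _ n]) (simp_all add: F hessian_quadratic Q)
qed

section \<open>Conservation of \<open>G1\<close>, \<open>G3\<close> and \<open>G4\<close>\<close>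

text \<open>The right-hand side is symmetric in \<open>p\<close>, \<open>q\<close>, \<open>r\<close>; this is what makes the terms of the time
  derivatives of \<open>G1\<close>, \<open>G3\<close>, \<open>G4\<close> cancel in pairs.\<close>

lemma weight_times_coefficient:
  fixes p q r :: real
  assumes "p + q \<noteq> 0" "p + r \<noteq> 0" "q + r \<noteq> 0" "p \<noteq> q"
  shows "2 / (p\<^sup>2 - q\<^sup>2) * (1 / (q + r) - 1 / (p + r)) = 2 / ((p + q) * (p + r) * (q + r))"
proof -
  have "p\<^sup>2 - q\<^sup>2 = (p - q) * (p + q)" by algebra
  moreover have "1 / (q + r) - 1 / (p + r) = (p - q) / ((p + r) * (q + r))"
    using assms by (simp add: field_simps)
  ultimately have "2 / (p\<^sup>2 - q\<^sup>2) * (1 / (q + r) - 1 / (p + r))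
      = ((p - q) * 2) / ((p - q) * ((p + q) * (p + r) * (q + r)))"
    by (simp only: times_divide_times_eq ac_simps)
  moreover have "p - q \<noteq> 0" using assms(4) by simp
  ultimately show ?thesis by (metis nonzero_mult_divide_mult_cancel_left)
qed

lemma G_diag_form:
  shows "G1 l p = diag_form (vector [0, 2 / ((l$1)\<^sup>2 - (l$3)\<^sup>2), 2 / ((l$1)\<^sup>2 - (l$2)\<^sup>2)])
      (vector [2 / ((l$1)\<^sup>2 - (l$4)\<^sup>2), 0, 0]) 0 0 p p / 2"
    and "G3 l p = diag_form (vector [2 / ((l$3)\<^sup>2 - (l$2)\<^sup>2), 2 / ((l$3)\<^sup>2 - (l$1)\<^sup>2), 0])
      (vector [0, 0, 2 / ((l$3)\<^sup>2 - (l$4)\<^sup>2)]) 0 0 p p / 2"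
    and "G4 l p = diag_form 0 (vector [2 / ((l$4)\<^sup>2 - (l$1)\<^sup>2), 2 / ((l$4)\<^sup>2 - (l$2)\<^sup>2),
      2 / ((l$4)\<^sup>2 - (l$3)\<^sup>2)]) 0 0 p p / 2"
  by (simp_all add: G1_def G3_def G4_def diag_form_def sum_3 power2_eq_square
      add_divide_distrib ac_simps split: prod.split)

text \<open>For the constant of motion with index i, the time derivative has three cubic monomials,
  one for each pair {j, k} of the other indices. Each coefficient vanishes by \<open>cancel\<close>,
  the symmetry of the weighted coefficient under exchanging j and k.\<close>

lemma rigid_body_G:
  assumes sum: "\<forall>i j. i \<noteq> j \<longrightarrow> l$i + l$j \<noteq> 0" and diff: "\<forall>i j. i \<noteq> j \<longrightarrow> l$i \<noteq> l$j"
  shows "diag_form (vector [0, 2 / ((l$1)\<^sup>2 - (l$3)\<^sup>2), 2 / ((l$1)\<^sup>2 - (l$2)\<^sup>2)])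
      (vector [2 / ((l$1)\<^sup>2 - (l$4)\<^sup>2), 0, 0]) 0 0 p (rigid_body l p) = 0"
    and "diag_form (vector [2 / ((l$3)\<^sup>2 - (l$2)\<^sup>2), 2 / ((l$3)\<^sup>2 - (l$1)\<^sup>2), 0])
      (vector [0, 0, 2 / ((l$3)\<^sup>2 - (l$4)\<^sup>2)]) 0 0 p (rigid_body l p) = 0"
    and "diag_form 0 (vector [2 / ((l$4)\<^sup>2 - (l$1)\<^sup>2), 2 / ((l$4)\<^sup>2 - (l$2)\<^sup>2),
      2 / ((l$4)\<^sup>2 - (l$3)\<^sup>2)]) 0 0 p (rigid_body l p) = 0"
proof -
  define D where "D i j = 2 / ((l$i)\<^sup>2 - (l$j)\<^sup>2)" for i j
  define r where "r i j = 1 / lam2 l i j" for i j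
  have r_sym: "r i j = r j i" for i j by (simp add: r_def lam2_def add.commute)
  have cancel: "D i j * (r j k - r i k) = D i k * (r j k - r i j)"
    if "i \<noteq> j" "i \<noteq> k" "j \<noteq> k" for i j k
    using weight_times_coefficient[of "l$i" "l$j" "l$k"] weight_times_coefficient[of "l$i" "l$k" "l$j"]
      that sum diff by (simp add: D_def r_def lam2_def ac_simps)
  obtain x y where p: "p = (x, y)" by (cases p)
  have r_swap: "r 2 1 = r 1 2" "r 3 1 = r 1 3" "r 4 1 = r 1 4" "r 3 2 = r 2 3" "r 4 2 = r 2 4"
    "r 4 3 = r 3 4" by (rule r_sym)+
  note expand = p diag_form_def rigid_body_def prod.case sum_3 vector_3 zero_index
    D_def[symmetric] r_def[symmetric] add_0 add_0_right mult_zero_left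
  show "diag_form (vector [0, 2 / ((l$1)\<^sup>2 - (l$3)\<^sup>2), 2 / ((l$1)\<^sup>2 - (l$2)\<^sup>2)])
      (vector [2 / ((l$1)\<^sup>2 - (l$4)\<^sup>2), 0, 0]) 0 0 p (rigid_body l p) = 0"
    unfolding expand
    using cancel[of 1 2 3, unfolded r_swap] cancel[of 1 2 4, unfolded r_swap]
      cancel[of 1 3 4, unfolded r_swap]
    by simp algebra
  show "diag_form (vector [2 / ((l$3)\<^sup>2 - (l$2)\<^sup>2), 2 / ((l$3)\<^sup>2 - (l$1)\<^sup>2), 0])
      (vector [0, 0, 2 / ((l$3)\<^sup>2 - (l$4)\<^sup>2)]) 0 0 p (rigid_body l p) = 0"
    unfolding expand
    using cancel[of 3 1 2, unfolded r_swap] cancel[of 3 1 4, unfolded r_swap]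
      cancel[of 3 2 4, unfolded r_swap]
    by simp algebra
  show "diag_form 0 (vector [2 / ((l$4)\<^sup>2 - (l$1)\<^sup>2), 2 / ((l$4)\<^sup>2 - (l$2)\<^sup>2),
      2 / ((l$4)\<^sup>2 - (l$3)\<^sup>2)]) 0 0 p (rigid_body l p) = 0"
    unfolding expand
    using cancel[of 4 1 2, unfolded r_swap] cancel[of 4 1 3, unfolded r_swap]
      cancel[of 4 2 3, unfolded r_swap]
    by simp algebra
qed

section \<open>The equilibria of the theorem\<close>

lemma M_axis:
  shows "M1 \<alpha> \<beta> = (axis 1 \<alpha>, axis 1 \<beta>)" and "M3 \<alpha> \<beta> = (axis 3 \<alpha>, axis 3 \<beta>)"
  by (simp_all add: M1_def M3_def axis_def vec_eq_iff forall_3 vector_3)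

theorem theorem3p1:
  fixes l :: "real^4" and c1 c2 a b :: real
  assumes "l$1 > l$2" and "l$2 > l$3" and "l$3 > l$4"
    and "\<And>i j. i \<noteq> j \<Longrightarrow> l$i + l$j > 0"
    and "c1 > 0" and "c1 > \<bar>c2\<bar>"
    and "a = 1 / sqrt 2 * (sqrt (c1 + c2) + sqrt (c1 - c2))"
    and "b = 1 / sqrt 2 * (sqrt (c1 + c2) - sqrt (c1 - c2))"
  shows "(nonlinearly_stable_with l (G3 l) (M1 a b) \<and>
          nonlinearly_stable_with l (G3 l) (M1 (-a) (-b))) \<and>
         (nonlinearly_stable_with l (G1 l) (M3 a b) \<and>
          nonlinearly_stable_with l (G1 l) (M3 (-a) (-b))) \<and>
         (nonlinearly_stable_with l (G4 l) (M3 b a) \<and>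
          nonlinearly_stable_with l (G4 l) (M3 (-b) (-a)))"
proof -
  \<comment> \<open>The condition \<open>c1 > \<bar>c2\<bar>\<close> makes both radicands positive,
    which yields the strict inequality required by \<open>regular\<close>.\<close>
  have "a\<^sup>2 - b\<^sup>2 = 2 * sqrt (c1 + c2) * sqrt (c1 - c2)"
    unfolding assms(7,8) by (simp add: power2_eq_square field_simps)
  also have "\<dots> > 0"
    using assms(6) by auto
  finally have ab: "b\<^sup>2 < a\<^sup>2" by simp
  \<comment> \<open>\<open>l$4\<close> may be negative; positivity of the pairwise sums still orders
    the squares.\<close>
  have sq: "(l$j)\<^sup>2 < (l$i)\<^sup>2" if "l$j < l$i" "i \<noteq> j" for i j
  proof -
    have "0 < (l$i - l$j) * (l$i + l$j)" using that assms(4) by simp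
    then show ?thesis by (simp add: power2_eq_square algebra_simps)
  qed
  have sq': "(l$4)\<^sup>2 < (l$3)\<^sup>2" "(l$3)\<^sup>2 < (l$2)\<^sup>2" "(l$2)\<^sup>2 < (l$1)\<^sup>2"
    using assms(1-3) by (auto intro!: sq)
  have sum: "\<forall>i j. i \<noteq> j \<longrightarrow> l$i + l$j \<noteq> 0"
    using assms(4) by (auto simp: less_le)
  have "\<forall>i j. i \<noteq> j \<longrightarrow> l$i \<noteq> l$j"
    using assms(1-3) by (auto simp: forall_4)
  note conserved = rigid_body_G[OF sum this]
  \<comment> \<open>Here s is the denominator at the index of the equilibrium and t another one. The
    condition makes \<open>2 / s\<close> extremal: positive and above \<open>2 / t\<close>, or
    negative and below it. The three values of s are \<open>(l$3)\<^sup>2 - (l$2)\<^sup>2\<close>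
    for \<open>G3\<close>, \<open>(l$1)\<^sup>2 - (l$2)\<^sup>2\<close> for \<open>G1\<close> and
    \<open>(l$4)\<^sup>2 - (l$3)\<^sup>2\<close> for \<open>G4\<close>.\<close>
  have gap: "0 < 2 / s * (2 / s - 2 / t)"
    if "0 < s \<and> (s < t \<or> t < 0) \<or> s < 0 \<and> (t < s \<or> 0 < t)" for s t :: real
  proof -
    have "2 / t < 2 / s \<and> 0 < 2 / s \<or> 2 / s < 2 / t \<and> 2 / s < 0"
      using that by (auto simp: field_simps)
    then show ?thesis by (auto intro: mult_pos_pos mult_neg_neg simp del: times_divide_eq_left)
  qed
  have three: "i = 1 \<or> i = 2 \<or> i = 3" for i :: 3 by (rule exhaust_3)
  have "nonlinearly_stable_with l (G3 l) (M1 \<alpha> \<beta>)" if "\<beta>\<^sup>2 < \<alpha>\<^sup>2" for \<alpha> \<beta>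
    unfolding M_axis
  proof (rule nonlinearly_stable_axis[OF G_diag_form(2) conserved(2)], goal_cases)
    case (1 i) then show ?case using three[of i] by auto
  next
    case (2 i) then show ?case
      using three[of i] sq'
      by (elim disjE) (simp_all add: gap del: times_divide_eq_left times_divide_eq_right)
  qed (use that in simp)
  moreover have "nonlinearly_stable_with l (G1 l) (M3 \<alpha> \<beta>)" if "\<beta>\<^sup>2 < \<alpha>\<^sup>2" for \<alpha> \<beta>
    unfolding M_axis
  proof (rule nonlinearly_stable_axis[OF G_diag_form(1) conserved(1)], goal_cases)
    case (1 i) then show ?case using three[of i] by auto
  next
    case (2 i) then show ?case
      using three[of i] sq'
      by (elim disjE) (simp_all add: gap del: times_divide_eq_left times_divide_eq_right)
  qed (use that in simp)
  moreover have "nonlinearly_stable_with l (G4 l) (M3 \<alpha> \<beta>)" if "\<alpha>\<^sup>2 < \<beta>\<^sup>2" for \<alpha> \<beta>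
    unfolding M_axis
  proof (rule nonlinearly_stable_axis[OF G_diag_form(3) conserved(3)], goal_cases)
    case (1 i) then show ?case using three[of i] by auto
  next
    case (2 i) then show ?case
      using three[of i] sq'
      by (elim disjE) (simp_all add: gap del: times_divide_eq_left times_divide_eq_right)
  qed (use that in simp)
  \<comment> \<open>Only the squares of \<alpha> and \<beta> enter the conditions, so the equilibria
    with both signs reversed are covered too.\<close>
  ultimately show ?thesis
    using ab by simp
qed

end
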